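(* Let $(\mathcal M, M, \overline a)$ and $(\mathcal N, N, \overline b)$ be pointed systems of the same parameter size in the same language $L$. Eloise has a winning strategy in the modal Ehrenfeucht-Fraïssé game $\mathrm{MEF}(\mathcal M,M,\overline a,\mathcal N,N,\overline b)$ if and only if $(\mathcal M,M,\overline a)$ is bisimilar with $(\mathcal N,N,\overline b)$, i.e. there is a bisimulation $\sim$ between $\mathcal M$ and $\mathcal N$ with $(M,\overline a)\sim(N,\overline b)$.
   Context: A potentialist system is a collection (possibly a proper class) of $L$-structures, called worlds, together with a collection of embeddings between them, containing the identity embeddings and closed under composition. "$\pi\colon M\to M'$ in $\mathcal M$" means that $\pi$ is one of the embeddings of $\mathcal M$. Class-sized systems are handled in a class theory such as Morse-Kelley with global choice (global choice is used in general to obtain strategies), or using Grothendieck universes. A pointed system is a triple $(\mathcal M,M,\overline a)$ with $\mathcal M$ a potentialist system, $M\in\mathcal M$ and $\overline a$ a finite tuple from $M$; its parameter size is the length of $\overline a$. $\pi(\overline a)$ is taken componentwise and $\overline a c$ is $\overline a$ with $c$ appended. A bisimulation between $\mathcal M$ and $\mathcal N$ is a non-empty relation $\sim$ matching pairs $(M,\overline a)$ with pairs $(N,\overline b)$, where $(\mathcal M,M,\overline a)$, $(\mathcal N,N,\overline b)$ are pointed systems of the same parameter size, such that whenever $(M,\overline a)\sim(N,\overline b)$: (B1) $\overline a\mapsto\overline b$ is a partial isomorphism, i.e. $\overline a$ in $M$ and $\overline b$ in $N$ satisfy the same atomic formulas; (B2) for any $c\in M$ there is $d\in N$ with $(M,\overline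 a c)\sim(N,\overline b d)$, and vice versa; (B3) for any $\pi\colon M\to M'$ in $\mathcal M$ there is $\rho\colon N\to N'$ in $\mathcal N$ with $(M',\pi(\overline a))\sim(N',\rho(\overline b))$, and vice versa. The game $\mathrm{MEF}(\mathcal M,M,\overline a,\mathcal N,N,\overline b)$ is played by Abelard and Eloise. Positions are quadruples $(U,\overline c,V,\overline d)$ with $(\mathcal M,U,\overline c)$ and $(\mathcal N,V,\overline d)$ pointed systems of the same parameter size; the initial position is $(M,\overline a,N,\overline b)$. From $(U,\overline c,V,\overline d)$ Abelard either (a) chooses $u\in U$ or $v\in V$, or (b) chooses $\pi\colon U\to U'$ in $\mathcal M$ or $\rho\colon V\to V'$ in $\mathcal N$. Eloise responds respectively by (a) choosing an element of the other structure, so that both $u\in U$ and $v\in V$ are chosen, the new position being $(U,\overline c u,V,\overline d v)$; or (b) choosing an embedding in the other system, so that both $\pi\colon U\to U'$ in $\mathcal M$ and $\rho\colon V\to V'$ in $\mathcal N$ are chosen, the new position being $(U',\pi(\overline c),V',\rho(\overline d))$. A play has length $\omega$ and is won by Eloise iff at every position $(U,\overline c,V,\overline d)$ of the play $\overline c$ in $U$ and $\overline d$ in $V$ satisfy the same atomic formulas. *)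

theory Defs
  imports Main "HOL-Library.FuncSet"
begin

section \<open>Languages, structures, atomic formulas\<close>

record ('f, 'r) lang =
  funs :: "'f set"
  fun_arity :: "'f \<Rightarrow> nat"
  rels :: "'r set"
  rel_arity :: "'r \<Rightarrow> nat"

record ('f, 'r, 'a) struct =
  carrier :: "'a set"
  fun_interp :: "'f \<Rightarrow> 'a list \<Rightarrow> 'a"
  rel_interp :: "'r \<Rightarrow> 'a list set"

definition tuples :: "nat \<Rightarrow> 'a set \<Rightarrow> 'a list set" where
  "tuples n A = {xs. set xs \<subseteq> A \<and> length xs = n}"

text \<open>
  Interpretations are extensional, so that two values of the record type describing the same
  structure are equal. Constants are function symbols of arity 0. Empty carriers are allowed.
\<close>

definition is_structure :: "('f, 'r) lang \<Rightarrow> ('f, 'r, 'a) struct \<Rightarrow> bool" where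
  "is_structure L M \<longleftrightarrow>
     fun_interp M \<in>
       (\<Pi>\<^sub>E F\<in>funs L. tuples (fun_arity L F) (carrier M) \<rightarrow>\<^sub>E carrier M) \<and>
     rel_interp M \<in> (\<Pi>\<^sub>E R\<in>rels L. Pow (tuples (rel_arity L R) (carrier M)))"

datatype 'f trm = Var nat | Fun 'f "'f trm list"

datatype ('f, 'r) atom = Eq "'f trm" "'f trm" | Rel 'r "'f trm list"

fun wf_trm :: "('f, 'r) lang \<Rightarrow> nat \<Rightarrow> 'f trm \<Rightarrow> bool" where
  "wf_trm L n (Var i) \<longleftrightarrow> i < n"
| "wf_trm L n (Fun F ts) \<longleftrightarrow>
     F \<in> funs L \<and> length ts = fun_arity L F \<and> (\<forall>t\<in>set ts. wf_trm L n t)"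

fun wf_atom :: "('f, 'r) lang \<Rightarrow> nat \<Rightarrow> ('f, 'r) atom \<Rightarrow> bool" where
  "wf_atom L n (Eq s t) \<longleftrightarrow> wf_trm L n s \<and> wf_trm L n t"
| "wf_atom L n (Rel R ts) \<longleftrightarrow>
     R \<in> rels L \<and> length ts = rel_arity L R \<and> (\<forall>t\<in>set ts. wf_trm L n t)"

fun eval :: "('f, 'r, 'a) struct \<Rightarrow> 'a list \<Rightarrow> 'f trm \<Rightarrow> 'a" where
  "eval M as (Var i) = as ! i"
| "eval M as (Fun F ts) = fun_interp M F (map (eval M as) ts)"

fun satisfies :: "('f, 'r, 'a) struct \<Rightarrow> 'a list \<Rightarrow> ('f, 'r) atom \<Rightarrow> bool" where
  "satisfies M as (Eq s t) \<longleftrightarrow> eval M as s = eval M as t"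
| "satisfies M as (Rel R ts) \<longleftrightarrow> map (eval M as) ts \<in> rel_interp M R"

definition same_atomic ::
  "('f, 'r) lang \<Rightarrow> ('f, 'r, 'a) struct \<Rightarrow> 'a list \<Rightarrow> ('f, 'r, 'b) struct \<Rightarrow> 'b list \<Rightarrow> bool" where
  "same_atomic L M as N bs \<longleftrightarrow>
     length as = length bs \<and>
     (\<forall>\<phi>. wf_atom L (length as) \<phi> \<longrightarrow> (satisfies M as \<phi> \<longleftrightarrow> satisfies N bs \<phi>))"


section \<open>Potentialist systems\<close>

text \<open>
  An embedding is a triple (domain, map, codomain), the map being extensional on the carrier of
  the domain.
\<close>

type_synonym ('f, 'r, 'a) emb = "('f, 'r, 'a) struct \<times> ('a \<Rightarrow> 'a) \<times> ('f, 'r, 'a) struct"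

fun is_embedding :: "('f, 'r) lang \<Rightarrow> ('f, 'r, 'a) emb \<Rightarrow> bool" where
  "is_embedding L (M, \<pi>, M') \<longleftrightarrow>
     \<pi> \<in> carrier M \<rightarrow>\<^sub>E carrier M' \<and> inj_on \<pi> (carrier M) \<and>
     (\<forall>F\<in>funs L. \<forall>xs\<in>tuples (fun_arity L F) (carrier M).
        \<pi> (fun_interp M F xs) = fun_interp M' F (map \<pi> xs)) \<and>
     (\<forall>R\<in>rels L. \<forall>xs\<in>tuples (rel_arity L R) (carrier M).
        xs \<in> rel_interp M R \<longleftrightarrow> map \<pi> xs \<in> rel_interp M' R)"

record ('f, 'r, 'a) system =
  worlds :: "('f, 'r, 'a) struct set"
  embs :: "('f, 'r, 'a) emb set"

definition potentialist_system :: "('f, 'r) lang \<Rightarrow> ('f, 'r, 'a) system \<Rightarrow> bool" where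
  "potentialist_system L S \<longleftrightarrow>
     (\<forall>M\<in>worlds S. is_structure L M) \<and>
     (\<forall>(M, \<pi>, M')\<in>embs S. M \<in> worlds S \<and> M' \<in> worlds S \<and> is_embedding L (M, \<pi>, M')) \<and>
     (\<forall>M\<in>worlds S. (M, restrict id (carrier M), M) \<in> embs S) \<and>
     (\<forall>M \<pi> M' \<pi>' M''. (M, \<pi>, M') \<in> embs S \<longrightarrow> (M', \<pi>', M'') \<in> embs S \<longrightarrow>
        (M, compose (carrier M) \<pi>' \<pi>, M'') \<in> embs S)"

definition pointed_system ::
  "('f, 'r) lang \<Rightarrow> ('f, 'r, 'a) system \<Rightarrow> ('f, 'r, 'a) struct \<Rightarrow> 'a list \<Rightarrow> bool" where
  "pointed_system L S M as \<longleftrightarrow>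
     potentialist_system L S \<and> M \<in> worlds S \<and> set as \<subseteq> carrier M"


section \<open>Bisimulations\<close>

type_synonym ('f, 'r, 'a, 'b) position =
  "('f, 'r, 'a) struct \<times> 'a list \<times> ('f, 'r, 'b) struct \<times> 'b list"

definition bisimulation ::
  "('f, 'r) lang \<Rightarrow> ('f, 'r, 'a) system \<Rightarrow> ('f, 'r, 'b) system \<Rightarrow>
   ('f, 'r, 'a, 'b) position set \<Rightarrow> bool" where
  "bisimulation L S T B \<longleftrightarrow>
     B \<noteq> {} \<and>
     (\<forall>(M, as, N, bs)\<in>B.
        pointed_system L S M as \<and> pointed_system L T N bs \<and> length as = length bs \<and>
        same_atomic L M as N bs \<and>
        (\<forall>c\<in>carrier M. \<exists>d\<in>carrier N. (M, as @ [c], N, bs @ [d]) \<in> B) \<and>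
        (\<forall>d\<in>carrier N. \<exists>c\<in>carrier M. (M, as @ [c], N, bs @ [d]) \<in> B) \<and>
        (\<forall>\<pi> M'. (M, \<pi>, M') \<in> embs S \<longrightarrow>
           (\<exists>\<rho> N'. (N, \<rho>, N') \<in> embs T \<and> (M', map \<pi> as, N', map \<rho> bs) \<in> B)) \<and>
        (\<forall>\<rho> N'. (N, \<rho>, N') \<in> embs T \<longrightarrow>
           (\<exists>\<pi> M'. (M, \<pi>, M') \<in> embs S \<and> (M', map \<pi> as, N', map \<rho> bs) \<in> B)))"

definition bisimilar ::
  "('f, 'r) lang \<Rightarrow> ('f, 'r, 'a) system \<Rightarrow> ('f, 'r, 'a) struct \<Rightarrow> 'a list \<Rightarrow>
   ('f, 'r, 'b) system \<Rightarrow> ('f, 'r, 'b) struct \<Rightarrow> 'b list \<Rightarrow> bool" where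
  "bisimilar L S M as T N bs \<longleftrightarrow> (\<exists>B. bisimulation L S T B \<and> (M, as, N, bs) \<in> B)"


section \<open>The modal Ehrenfeucht-Fraisse game\<close>

text \<open>
  Both players use the same type of moves. \<open>ElemL\<close> and \<open>EmbL\<close> are choices in the first system,
  \<open>ElemR\<close> and \<open>EmbR\<close> choices in the second. A round consists of a move of Abelard and the answer
  of Eloise.
\<close>

datatype ('f, 'r, 'a, 'b) move =
    ElemL 'a
  | ElemR 'b
  | EmbL "('f, 'r, 'a) emb"
  | EmbR "('f, 'r, 'b) emb"

type_synonym ('f, 'r, 'a, 'b) round = "('f, 'r, 'a, 'b) move \<times> ('f, 'r, 'a, 'b) move"

fun available ::
  "('f, 'r, 'a) system \<Rightarrow> ('f, 'r, 'b) system \<Rightarrow>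
   ('f, 'r, 'a, 'b) position \<Rightarrow> ('f, 'r, 'a, 'b) move \<Rightarrow> bool" where
  "available S T (U, cs, V, ds) (ElemL u) \<longleftrightarrow> u \<in> carrier U"
| "available S T (U, cs, V, ds) (ElemR v) \<longleftrightarrow> v \<in> carrier V"
| "available S T (U, cs, V, ds) (EmbL e) \<longleftrightarrow> e \<in> embs S \<and> fst e = U"
| "available S T (U, cs, V, ds) (EmbR e) \<longleftrightarrow> e \<in> embs T \<and> fst e = V"

fun answers :: "('f, 'r, 'a, 'b) move \<Rightarrow> ('f, 'r, 'a, 'b) move \<Rightarrow> bool" where
  "answers (ElemL _) (ElemR _) \<longleftrightarrow> True"
| "answers (ElemR _) (ElemL _) \<longleftrightarrow> True"
| "answers (EmbL _) (EmbR _) \<longleftrightarrow> True"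
| "answers (EmbR _) (EmbL _) \<longleftrightarrow> True"
| "answers _ _ \<longleftrightarrow> False"

definition legal_answer ::
  "('f, 'r, 'a) system \<Rightarrow> ('f, 'r, 'b) system \<Rightarrow> ('f, 'r, 'a, 'b) position \<Rightarrow>
   ('f, 'r, 'a, 'b) move \<Rightarrow> ('f, 'r, 'a, 'b) move \<Rightarrow> bool" where
  "legal_answer S T p m r \<longleftrightarrow> answers m r \<and> available S T p r"

text \<open>Only the value at legal rounds matters; the last equation is a dummy.\<close>

fun next_position ::
  "('f, 'r, 'a, 'b) position \<Rightarrow> ('f, 'r, 'a, 'b) round \<Rightarrow> ('f, 'r, 'a, 'b) position" where
  "next_position (U, cs, V, ds) (ElemL u, ElemR v) = (U, cs @ [u], V, ds @ [v])"
| "next_position (U, cs, V, ds) (ElemR v, ElemL u) = (U, cs @ [u], V, ds @ [v])"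
| "next_position (U, cs, V, ds) (EmbL (_, \<pi>, U'), EmbR (_, \<rho>, V')) =
     (U', map \<pi> cs, V', map \<rho> ds)"
| "next_position (U, cs, V, ds) (EmbR (_, \<rho>, V'), EmbL (_, \<pi>, U')) =
     (U', map \<pi> cs, V', map \<rho> ds)"
| "next_position p _ = p"

definition position_after ::
  "('f, 'r, 'a, 'b) position \<Rightarrow> ('f, 'r, 'a, 'b) round list \<Rightarrow> ('f, 'r, 'a, 'b) position" where
  "position_after p h = foldl next_position p h"

text \<open>
  A strategy of Eloise answers a move of Abelard depending on the rounds played before.
  Finite partial plays are needed because Eloise must never be left without a legal answer, which
  a condition on infinite plays alone would not express.
\<close>

type_synonym ('f, 'r, 'a, 'b) strategy =
  "('f, 'r, 'a, 'b) round list \<Rightarrow> ('f, 'r, 'a, 'b) move \<Rightarrow> ('f, 'r, 'a, 'b) move"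

definition legal_round ::
  "('f, 'r, 'a) system \<Rightarrow> ('f, 'r, 'b) system \<Rightarrow>
   ('f, 'r, 'a, 'b) position \<Rightarrow> ('f, 'r, 'a, 'b) round \<Rightarrow> bool" where
  "legal_round S T p r \<longleftrightarrow> available S T p (fst r) \<and> legal_answer S T p (fst r) (snd r)"

definition partial_play ::
  "('f, 'r, 'a) system \<Rightarrow> ('f, 'r, 'b) system \<Rightarrow> ('f, 'r, 'a, 'b) position \<Rightarrow>
   ('f, 'r, 'a, 'b) strategy \<Rightarrow> ('f, 'r, 'a, 'b) round list \<Rightarrow> bool" where
  "partial_play S T p \<sigma> h \<longleftrightarrow>
     (\<forall>i<length h. legal_round S T (position_after p (take i h)) (h ! i) \<and>
        snd (h ! i) = \<sigma> (take i h) (fst (h ! i)))"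

definition play ::
  "('f, 'r, 'a) system \<Rightarrow> ('f, 'r, 'b) system \<Rightarrow> ('f, 'r, 'a, 'b) position \<Rightarrow>
   ('f, 'r, 'a, 'b) strategy \<Rightarrow> (nat \<Rightarrow> ('f, 'r, 'a, 'b) round) \<Rightarrow> bool" where
  "play S T p \<sigma> x \<longleftrightarrow> (\<forall>n. partial_play S T p \<sigma> (map x [0..<n]))"

definition won_by_eloise ::
  "('f, 'r) lang \<Rightarrow> ('f, 'r, 'a, 'b) position \<Rightarrow> (nat \<Rightarrow> ('f, 'r, 'a, 'b) round) \<Rightarrow> bool" where
  "won_by_eloise L p x \<longleftrightarrow>
     (\<forall>n. case position_after p (map x [0..<n]) of (U, cs, V, ds) \<Rightarrow> same_atomic L U cs V ds)"

definition winning_strategy ::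
  "('f, 'r) lang \<Rightarrow> ('f, 'r, 'a) system \<Rightarrow> ('f, 'r, 'b) system \<Rightarrow>
   ('f, 'r, 'a, 'b) position \<Rightarrow> ('f, 'r, 'a, 'b) strategy \<Rightarrow> bool" where
  "winning_strategy L S T p \<sigma> \<longleftrightarrow>
     (\<forall>h m. partial_play S T p \<sigma> h \<longrightarrow> available S T (position_after p h) m \<longrightarrow>
        legal_answer S T (position_after p h) m (\<sigma> h m)) \<and>
     (\<forall>x. play S T p \<sigma> x \<longrightarrow> won_by_eloise L p x)"

text \<open>\<open>MEF_win\<close>: Eloise has a winning strategy in the game MEF(S, M, as, T, N, bs).\<close>

definition MEF_win ::
  "('f, 'r) lang \<Rightarrow> ('f, 'r, 'a) system \<Rightarrow> ('f, 'r, 'a) struct \<Rightarrow> 'a list \<Rightarrow>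
   ('f, 'r, 'b) system \<Rightarrow> ('f, 'r, 'b) struct \<Rightarrow> 'b list \<Rightarrow> bool" where
  "MEF_win L S M as T N bs \<longleftrightarrow> (\<exists>\<sigma>. winning_strategy L S T (M, as, N, bs) \<sigma>)"

end

theory Submission
  imports Defs
begin

text \<open>
  The four back-and-forth clauses of a bisimulation are exactly the four kinds of moves of Abelard,
  each with its demand on the answer. Read this way
  (\<open>bisimulation_iff_closed_under_answers\<close>), a bisimulation is a non-empty set of positions, all
  satisfying the atomic condition, in which Eloise can stay for one more round, whatever Abelard
  does.

  If such a set contains the initial position, Eloise wins by always choosing an answer that leads
  back into it; the current position determines a suitable answer, and the axiom of choice turns
  these answers into a strategy.

  Conversely, the positions that can be reached while Eloise follows a winning strategy form such a
  set. They allow one more round because the strategy always supplies a legal answer. That they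
  satisfy the same atomic formulas needs an argument, since the winning condition speaks only of
  infinite plays: a partial play must be prolonged to an infinite one
  (\<open>partial_play_extends_to_play\<close>). This is possible because Abelard always has a move, the
  identity embedding of the current world.
\<close>

section \<open>Positions and rounds\<close>

fun pointed_position ::
  "('f, 'r) lang \<Rightarrow> ('f, 'r, 'a) system \<Rightarrow> ('f, 'r, 'b) system \<Rightarrow>
   ('f, 'r, 'a, 'b) position \<Rightarrow> bool" where
  "pointed_position L S T (U, cs, V, ds) \<longleftrightarrow>
     pointed_system L S U cs \<and> pointed_system L T V ds \<and> length cs = length ds"

fun atomically_equivalent :: "('f, 'r) lang \<Rightarrow> ('f, 'r, 'a, 'b) position \<Rightarrow> bool" where
  "atomically_equivalent L (U, cs, V, ds) \<longleftrightarrow> same_atomic L U cs V ds"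

lemma pointed_system_snoc:
  assumes "pointed_system L S U cs" and "u \<in> carrier U"
  shows "pointed_system L S U (cs @ [u])"
  using assms by (simp add: pointed_system_def)

lemma pointed_system_map_embedding:
  assumes "pointed_system L S U cs" and emb: "(U, \<pi>, U') \<in> embs S"
  shows "pointed_system L S U' (map \<pi> cs)"
proof -
  have S: "potentialist_system L S" and cs: "set cs \<subseteq> carrier U"
    using assms by (auto simp: pointed_system_def)
  have "U' \<in> worlds S" and "\<pi> \<in> carrier U \<rightarrow>\<^sub>E carrier U'"
    using S emb by (fastforce simp: potentialist_system_def)+
  then show ?thesis
    using S cs by (auto simp: pointed_system_def)
qed

lemma legal_round_cases:
  assumes "legal_round S T (U, cs, V, ds) (m, r)"
  obtains
    (elements) u v where "u \<in> carrier U" "v \<in> carrier V"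
      "next_position (U, cs, V, ds) (m, r) = (U, cs @ [u], V, ds @ [v])"
  | (embeddings) \<pi> U' \<rho> V' where "(U, \<pi>, U') \<in> embs S" "(V, \<rho>, V') \<in> embs T"
      "next_position (U, cs, V, ds) (m, r) = (U', map \<pi> cs, V', map \<rho> ds)"
  using assms
  by (cases m; cases r) (auto simp: legal_round_def legal_answer_def)

lemma pointed_position_next_position:
  assumes "pointed_position L S T p" and "legal_round S T p x"
  shows "pointed_position L S T (next_position p x)"
proof -
  obtain U cs V ds m r where [simp]: "p = (U, cs, V, ds)" "x = (m, r)"
    by (metis prod.exhaust)
  have "legal_round S T (U, cs, V, ds) (m, r)"
    using assms(2) by simp
  then show ?thesis
    using assms(1)
    by (cases rule: legal_round_cases)
       (auto intro: pointed_system_snoc pointed_system_map_embedding)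
qed

text \<open>
  This is where the closure of a potentialist system under identities enters: without it, a game
  could come to a dead end for Abelard.
\<close>

lemma available_move_exists:
  assumes "pointed_position L S T p"
  obtains m where "available S T p m"
proof -
  obtain U cs V ds where p: "p = (U, cs, V, ds)"
    by (metis prod.exhaust)
  have "(U, restrict id (carrier U), U) \<in> embs S"
    using assms by (auto simp: p pointed_system_def potentialist_system_def)
  then have "available S T p (EmbL (U, restrict id (carrier U), U))"
    by (simp add: p)
  then show ?thesis by (rule that)
qed


section \<open>Bisimulations in terms of rounds\<close>

definition answerable ::
  "('f, 'r, 'a) system \<Rightarrow> ('f, 'r, 'b) system \<Rightarrow> ('f, 'r, 'a, 'b) position set \<Rightarrow>
   ('f, 'r, 'a, 'b) position \<Rightarrow> bool" where
  "answerable S T B p \<longleftrightarrow>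
     (\<forall>m. available S T p m \<longrightarrow> (\<exists>r. legal_answer S T p m r \<and> next_position p (m, r) \<in> B))"

lemma all_moves_iff:
  "(\<forall>m. P m) \<longleftrightarrow>
     (\<forall>u. P (ElemL u)) \<and> (\<forall>v. P (ElemR v)) \<and>
     (\<forall>U \<pi> U'. P (EmbL (U, \<pi>, U'))) \<and> (\<forall>V \<rho> V'. P (EmbR (V, \<rho>, V')))"
  by (metis move.exhaust prod.exhaust)

lemma ex_move_iff:
  "(\<exists>m. P m) \<longleftrightarrow>
     (\<exists>u. P (ElemL u)) \<or> (\<exists>v. P (ElemR v)) \<or>
     (\<exists>U \<pi> U'. P (EmbL (U, \<pi>, U'))) \<or> (\<exists>V \<rho> V'. P (EmbR (V, \<rho>, V')))"
  by (metis move.exhaust prod.exhaust)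

text \<open>
  Splitting Abelard's move into its four kinds yields the two directions of the two back-and-forth
  conditions.
\<close>

lemma answerable_iff:
  "answerable S T B (U, cs, V, ds) \<longleftrightarrow>
     (\<forall>c\<in>carrier U. \<exists>d\<in>carrier V. (U, cs @ [c], V, ds @ [d]) \<in> B) \<and>
     (\<forall>d\<in>carrier V. \<exists>c\<in>carrier U. (U, cs @ [c], V, ds @ [d]) \<in> B) \<and>
     (\<forall>\<pi> U'. (U, \<pi>, U') \<in> embs S \<longrightarrow>
        (\<exists>\<rho> V'. (V, \<rho>, V') \<in> embs T \<and> (U', map \<pi> cs, V', map \<rho> ds) \<in> B)) \<and>
     (\<forall>\<rho> V'. (V, \<rho>, V') \<in> embs T \<longrightarrow>
        (\<exists>\<pi> U'. (U, \<pi>, U') \<in> embs S \<and> (U', map \<pi> cs, V', map \<rho> ds) \<in> B))"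
  unfolding answerable_def all_moves_iff ex_move_iff Ball_def Bex_def
  by (simp add: legal_answer_def)

lemma bisimulation_iff_closed_under_answers:
  "bisimulation L S T B \<longleftrightarrow>
     B \<noteq> {} \<and>
     (\<forall>p\<in>B. pointed_position L S T p \<and> atomically_equivalent L p \<and> answerable S T B p)"
  unfolding bisimulation_def
  by (intro arg_cong2[where f = "(\<and>)"] ball_cong refl)
     (simp only: split_paired_all case_prod_conv pointed_position.simps
        atomically_equivalent.simps answerable_iff conj_assoc)


section \<open>Plays\<close>

lemma position_after_Nil [simp]: "position_after p [] = p"
  by (simp add: position_after_def)

lemma position_after_snoc [simp]:
  "position_after p (h @ [x]) = next_position (position_after p h) x"
  by (simp add: position_after_def)

lemma partial_play_Nil [simp]: "partial_play S T p \<sigma> []"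
  by (simp add: partial_play_def)

lemma partial_play_snoc [simp]:
  "partial_play S T p \<sigma> (h @ [x]) \<longleftrightarrow>
     partial_play S T p \<sigma> h \<and> legal_round S T (position_after p h) x \<and> snd x = \<sigma> h (fst x)"
  by (auto simp: partial_play_def nth_append less_Suc_eq)

lemma partial_play_take:
  assumes "partial_play S T p \<sigma> h"
  shows "partial_play S T p \<sigma> (take n h)"
  using assms by (auto simp: partial_play_def min_def)

lemma pointed_position_after:
  assumes "pointed_position L S T p" and "partial_play S T p \<sigma> h"
  shows "pointed_position L S T (position_after p h)"
  using assms(2)
  by (induction h rule: rev_induct)
     (use assms(1) in \<open>auto intro: pointed_position_next_position\<close>)

lemma won_by_eloise_iff:
  "won_by_eloise L p x \<longleftrightarrow>
     (\<forall>n. atomically_equivalent L (position_after p (map x [0..<n])))"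
  unfolding won_by_eloise_def
  by (intro iff_allI) (auto split: prod.split)

definition always_answers_legally ::
  "('f, 'r, 'a) system \<Rightarrow> ('f, 'r, 'b) system \<Rightarrow> ('f, 'r, 'a, 'b) position \<Rightarrow>
   ('f, 'r, 'a, 'b) strategy \<Rightarrow> bool" where
  "always_answers_legally S T p \<sigma> \<longleftrightarrow>
     (\<forall>h m. partial_play S T p \<sigma> h \<longrightarrow> available S T (position_after p h) m \<longrightarrow>
        legal_answer S T (position_after p h) m (\<sigma> h m))"

text \<open>
  Starting from the given partial play, rounds in which Abelard makes some available move and
  Eloise follows \<open>\<sigma>\<close> are added forever. The partial plays so obtained extend one another, and
  their diagonal is the infinite play.
\<close>

lemma partial_play_extends_to_play:
  assumes p: "pointed_position L S T p"
    and \<sigma>: "always_answers_legally S T p \<sigma>"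
    and h: "partial_play S T p \<sigma> h"
  obtains x where "play S T p \<sigma> x" and "map x [0..<length h] = h"
proof -
  define step where
    "step g = (let m = (SOME m. available S T (position_after p g) m) in g @ [(m, \<sigma> g m)])" for g
  define H where "H k = (step ^^ k) h" for k
  have H_0: "H 0 = h" and H_Suc: "H (Suc k) = step (H k)" for k
    by (simp_all add: H_def)
  have step: "partial_play S T p \<sigma> (step g)" if g: "partial_play S T p \<sigma> g" for g
  proof -
    let ?q = "position_after p g"
    obtain m where "available S T ?q m"
      using pointed_position_after[OF p g] by (rule available_move_exists)
    then have "available S T ?q (SOME m. available S T ?q m)"
      by (rule someI)
    then show ?thesis
      using g \<sigma> by (simp add: step_def Let_def legal_round_def always_answers_legally_def)
  qed
  have pp: "partial_play S T p \<sigma> (H k)" for k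
    by (induction k) (simp_all add: H_0 H_Suc h step)
  have len: "length (H k) = length h + k" for k
    by (induction k) (simp_all add: H_0 H_Suc step_def Let_def)
  have take_H: "take (length h + k) (H (k + j)) = H k" for k j
  proof (induction j)
    case 0
    then show ?case by (simp add: len)
  next
    case (Suc j)
    then show ?case by (simp add: H_Suc step_def Let_def len)
  qed
  \<comment> \<open>\<open>H (Suc n)\<close> has length at least \<open>Suc n\<close>, so that its entry number \<open>n\<close> is defined.\<close>
  define x where "x n = H (Suc n) ! n" for n
  have x: "x n = H k ! n" if "n < length h + k" for n k
  proof (cases "k \<le> Suc n")
    case True
    then have "take (length h + k) (H (Suc n)) = H k"
      using take_H[of k "Suc n - k"] by simp
    then show ?thesis
      unfolding x_def using nth_take[OF that, of "H (Suc n)"] by simp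
  next
    case False
    then have "take (length h + Suc n) (H k) = H (Suc n)"
      using take_H[of "Suc n" "k - Suc n"] by simp
    then show ?thesis
      unfolding x_def using nth_take[of n "length h + Suc n" "H k"] by simp
  qed
  have prefix: "map x [0..<n] = take n (H k)" if "n \<le> length h + k" for n k
    using that by (intro nth_equalityI) (simp_all add: len x)
  have "play S T p \<sigma> x"
    unfolding play_def using prefix[OF le_add2] pp by (metis partial_play_take)
  moreover have "map x [0..<length h] = h"
    using prefix[of "length h" 0] by (simp add: H_0)
  ultimately show ?thesis by (rule that)
qed


section \<open>Winning strategies and bisimulations\<close>

definition reachable_positions ::
  "('f, 'r, 'a) system \<Rightarrow> ('f, 'r, 'b) system \<Rightarrow> ('f, 'r, 'a, 'b) position \<Rightarrow>
   ('f, 'r, 'a, 'b) strategy \<Rightarrow> ('f, 'r, 'a, 'b) position set" where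
  "reachable_positions S T p \<sigma> = {position_after p h |h. partial_play S T p \<sigma> h}"

lemma initial_position_reachable: "p \<in> reachable_positions S T p \<sigma>"
  by (auto simp: reachable_positions_def intro: exI[of _ "[]"])

text \<open>
  The answers prescribed by the strategy lead from reachable positions to reachable positions, and
  a reachable position occurs in an infinite play, which is won by Eloise.
\<close>

lemma winning_strategy_imp_bisimulation:
  assumes p: "pointed_position L S T p" and win: "winning_strategy L S T p \<sigma>"
  shows "bisimulation L S T (reachable_positions S T p \<sigma>)"
proof -
  let ?B = "reachable_positions S T p \<sigma>"
  have legal: "always_answers_legally S T p \<sigma>"
    using win by (simp add: winning_strategy_def always_answers_legally_def)
  have "pointed_position L S T q \<and> atomically_equivalent L q \<and> answerable S T ?B q"
    if "q \<in> ?B" for q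
  proof -
    obtain h where q: "q = position_after p h" and h: "partial_play S T p \<sigma> h"
      using \<open>q \<in> ?B\<close> by (auto simp: reachable_positions_def)
    obtain x where "play S T p \<sigma> x" and x: "map x [0..<length h] = h"
      using partial_play_extends_to_play[OF p legal h] .
    then have "won_by_eloise L p x"
      using win by (simp add: winning_strategy_def)
    then have "atomically_equivalent L q"
      unfolding won_by_eloise_iff q using x by metis
    moreover have "answerable S T ?B q"
      unfolding answerable_def
    proof (intro allI impI exI conjI)
      fix m
      assume m: "available S T q m"
      show la: "legal_answer S T q m (\<sigma> h m)"
        using legal h m by (simp add: always_answers_legally_def q)
      have "partial_play S T p \<sigma> (h @ [(m, \<sigma> h m)])"
        using h m la by (simp add: legal_round_def q)
      then show "next_position q (m, \<sigma> h m) \<in> ?B"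
        unfolding reachable_positions_def q position_after_snoc[symmetric] by blast
    qed
    ultimately show ?thesis
      using pointed_position_after[OF p h] q by blast
  qed
  then show ?thesis
    unfolding bisimulation_iff_closed_under_answers
    using initial_position_reachable by blast
qed

text \<open>
  Eloise's strategy depends on the history only through the current position: any legal answer that
  stays in the bisimulation will do.
\<close>

lemma bisimulation_imp_winning_strategy:
  assumes B: "bisimulation L S T B" and p: "p \<in> B"
  obtains \<sigma> where "winning_strategy L S T p \<sigma>"
proof -
  define good where
    "good q m r \<longleftrightarrow> legal_answer S T q m r \<and> next_position q (m, r) \<in> B" for q m r
  define \<sigma> where "\<sigma> h m = (SOME r. good (position_after p h) m r)" for h m
  have equiv: "atomically_equivalent L q" and ans: "answerable S T B q" if "q \<in> B" for q
    using B that by (auto simp: bisimulation_iff_closed_under_answers)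
  have good: "good (position_after p h) m (\<sigma> h m)"
    if "position_after p h \<in> B" "available S T (position_after p h) m" for h m
  proof -
    have "\<exists>r. good (position_after p h) m r"
      using ans[OF that(1)] that(2) unfolding good_def answerable_def by blast
    then show ?thesis unfolding \<sigma>_def by (rule someI_ex)
  qed
  have in_B: "position_after p h \<in> B" if "partial_play S T p \<sigma> h" for h
    using that
  proof (induction h rule: rev_induct)
    case Nil
    then show ?case using p by simp
  next
    case (snoc x h)
    then have "position_after p h \<in> B" and "available S T (position_after p h) (fst x)"
      and "x = (fst x, \<sigma> h (fst x))"
      by (auto simp: legal_round_def prod_eq_iff)
    then show ?case
      using good unfolding good_def position_after_snoc by metis
  qed
  have "winning_strategy L S T p \<sigma>"
    unfolding winning_strategy_def
  proof (intro conjI allI impI)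
    fix h m
    assume "partial_play S T p \<sigma> h" and "available S T (position_after p h) m"
    then show "legal_answer S T (position_after p h) m (\<sigma> h m)"
      using good in_B unfolding good_def by blast
  next
    fix x
    assume "play S T p \<sigma> x"
    then show "won_by_eloise L p x"
      unfolding won_by_eloise_iff play_def using in_B equiv by blast
  qed
  then show ?thesis by (rule that)
qed

theorem theorem35:
  fixes L :: "('f, 'r) lang"
    and S :: "('f, 'r, 'a) system" and M :: "('f, 'r, 'a) struct" and as :: "'a list"
    and T :: "('f, 'r, 'b) system" and N :: "('f, 'r, 'b) struct" and bs :: "'b list"
  assumes "pointed_system L S M as"
    and "pointed_system L T N bs"
    and "length as = length bs"
  shows "MEF_win L S M as T N bs \<longleftrightarrow> bisimilar L S M as T N bs"
proof -
  have "pointed_position L S T (M, as, N, bs)"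
    using assms by simp
  then show ?thesis
    unfolding MEF_win_def bisimilar_def
    using winning_strategy_imp_bisimulation initial_position_reachable
      bisimulation_imp_winning_strategy
    by metis
qed

end
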